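(* Let $\mathcal{H}$ be a real Hilbert space, let $F=\sum_{i=1}^N F_i$ where each $F_i:\mathcal{H}\to\mathcal{H}$ satisfies $\|F_i(x)-F_i(y)\|\le L_i\|x-y\|^{\alpha_i}$ for all $x,y\in\mathcal{H}$, with $\alpha_i\in(0,1]$ and $L_i>0$ ($i=1,\dots,N$). Let $G:\mathcal{H}\to 2^{\mathcal{H}}$ be maximally monotone, let $T:=F+G$ be monotone, and assume $\mathrm{SOL}:=\{x\in\mathcal{H}\mid 0\in T(x)\}\neq\emptyset$. Put $\alpha=\min_{1\le i\le N}\alpha_i$, let $d\in(0,1)$, $0<s\le\min_{1\le i\le N}\frac{1}{NL_i\sqrt{\alpha_i}}$, and $$s_{k+1}=\frac{ds}{(k+1)^{\frac{1-\alpha}{2}}},\qquad k=0,1,2,\dots$$ Let $x_0\in\mathcal{H}$ and let $\{x_k\}$, $\{y_{k+1}\}$ be generated, for $k\ge 0$, by Tseng's splitting method $$y_{k+1}=J_{s_{k+1}G}\bigl(x_k-s_{k+1}F(x_k)\bigr),\qquad x_{k+1}=y_{k+1}-s_{k+1}\bigl(F(y_{k+1})-F(x_k)\bigr).$$ Then $$\min_{0\le k\le K}\mathrm{dist}\bigl(0,T(y_{k+1})\bigr)^2\le O\left(\left(\frac{(2+2d^2)\alpha}{1-d^2}+\sum_{i=1}^N\frac{(1-\alpha_i)\alpha d^2\ln(K)}{N(1-d^2)\alpha_i}\right)K^{-\alpha}\right).$$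
   Context: A set-valued operator $T:\mathcal{H}\to 2^{\mathcal{H}}$ is monotone if $\langle u-v,x-y\rangle\ge 0$ for all $x,y\in\mathcal{H}$, $u\in T(x)$, $v\in T(y)$; it is maximally monotone if moreover its graph $\{(x,u)\mid u\in T(x)\}$ is not a proper subset of the graph of another monotone operator. $T(x)=F(x)+G(x)=\{F(x)+g\mid g\in G(x)\}$. For $s>0$ and $G$ maximally monotone, $J_{sG}:=(I+sG)^{-1}$, which is a single-valued map defined on all of $\mathcal{H}$. For $x\in\mathcal{H}$ and $\mathcal{S}\subset\mathcal{H}$, $\mathrm{dist}(x,\mathcal{S})=\inf_{y\in\mathcal{S}}\|x-y\|$. The notation $O(\cdot)$ is as $K\to\infty$, with the problem data, the parameters and the starting point fixed (the implied constant does not depend on $K$). *)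

theory Defs
  imports "HOL-Analysis.Analysis" "HOL-Library.Landau_Symbols"
begin

text \<open>A real Hilbert space is a type of sort \<open>{real_inner, complete_space}\<close>. A set-valued operator
  on it is a function \<open>'a \<Rightarrow> 'a set\<close>; its values may be empty.\<close>

definition op_graph :: "('a \<Rightarrow> 'b set) \<Rightarrow> ('a \<times> 'b) set" where
  "op_graph T = {(x, u). u \<in> T x}"

definition monotone_operator :: "('a::real_inner \<Rightarrow> 'a set) \<Rightarrow> bool" where
  "monotone_operator T \<longleftrightarrow> (\<forall>x y. \<forall>u\<in>T x. \<forall>v\<in>T y. (u - v) \<bullet> (x - y) \<ge> 0)"

definition maximally_monotone :: "('a::real_inner \<Rightarrow> 'a set) \<Rightarrow> bool" where
  "maximally_monotone T \<longleftrightarrow>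
     monotone_operator T \<and> \<not> (\<exists>S. monotone_operator S \<and> op_graph T \<subset> op_graph S)"

definition op_plus :: "('a::real_vector \<Rightarrow> 'a) \<Rightarrow> ('a \<Rightarrow> 'a set) \<Rightarrow> 'a \<Rightarrow> 'a set" where
  "op_plus F G x = {F x + g | g. g \<in> G x}"

definition op_scale :: "real \<Rightarrow> ('a::real_vector \<Rightarrow> 'a set) \<Rightarrow> 'a \<Rightarrow> 'a set" where
  "op_scale s G x = {s *\<^sub>R g | g. g \<in> G x}"

definition op_inverse :: "('a \<Rightarrow> 'b set) \<Rightarrow> 'b \<Rightarrow> 'a set" where
  "op_inverse A u = {x. u \<in> A x}"

text \<open>The resolvent is the inverse in the sense of set-valued operators. For \<open>s > 0\<close> and maximally
  monotone \<open>G\<close> every value is a singleton (Minty), so that \<open>y \<in> resolvent s G x\<close> expresses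
  \<open>y = (I + s G)\<^sup>-\<^sup>1 x\<close>; the uniqueness half of this is the lemma below.\<close>

definition resolvent :: "real \<Rightarrow> ('a::real_vector \<Rightarrow> 'a set) \<Rightarrow> 'a \<Rightarrow> 'a set" where
  "resolvent s G = op_inverse (op_plus (\<lambda>x. x) (op_scale s G))"

lemma resolvent_unique:
  fixes G :: "'a::real_inner \<Rightarrow> 'a set"
  assumes "monotone_operator G" and "s > 0"
    and "y \<in> resolvent s G x" and "z \<in> resolvent s G x"
  shows "y = z"
proof -
  obtain g where g: "g \<in> G y" "x = y + s *\<^sub>R g"
    using assms(3) by (auto simp: resolvent_def op_inverse_def op_plus_def op_scale_def)
  obtain h where h: "h \<in> G z" "x = z + s *\<^sub>R h"
    using assms(4) by (auto simp: resolvent_def op_inverse_def op_plus_def op_scale_def)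
  have eq: "y - z = - (s *\<^sub>R (g - h))"
    using g(2) h(2) by (simp add: algebra_simps)
  have "(g - h) \<bullet> (y - z) \<ge> 0"
    using assms(1) g(1) h(1) unfolding monotone_operator_def by blast
  hence "s * ((g - h) \<bullet> (y - z)) \<ge> 0"
    using assms(2) by simp
  moreover have "(y - z) \<bullet> (y - z) = - (s * ((g - h) \<bullet> (y - z)))"
    by (subst (1) eq) simp
  ultimately have "(y - z) \<bullet> (y - z) \<le> 0" by linarith
  hence "(y - z) \<bullet> (y - z) = 0" using inner_ge_zero[of "y - z"] by (rule antisym)
  thus ?thesis by simp
qed

end

theory Submission
  imports Defs
begin

text \<open>With \<open>r\<^sub>k = \<parallel>x\<^sub>k - y\<^bsub>k+1\<^esub>\<parallel>\<close>, the inclusion defining \<open>y\<^bsub>k+1\<^esub>\<close> produces an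
  element \<open>u\<^sub>k \<in> T y\<^bsub>k+1\<^esub>\<close> for which Tseng's method is the plain step
  \<open>x\<^bsub>k+1\<^esub> = x\<^sub>k - s\<^bsub>k+1\<^esub> u\<^sub>k\<close>. Monotonicity of \<open>T\<close> against a solution \<open>p\<close> then gives
  \<open>\<parallel>x\<^bsub>k+1\<^esub> - p\<parallel>\<^sup>2 \<le> \<parallel>x\<^sub>k - p\<parallel>\<^sup>2 - r\<^sub>k\<^sup>2 + E\<^sub>k\<close> with the error
  \<open>E\<^sub>k = s\<^bsub>k+1\<^esub>\<^sup>2 \<parallel>F y\<^bsub>k+1\<^esub> - F x\<^sub>k\<parallel>\<^sup>2\<close> (lemma \<open>tseng_step\<close>). For a Lipschitz \<open>F\<close> a small
  step makes \<open>E\<^sub>k\<close> at most a fraction of \<open>r\<^sub>k\<^sup>2\<close>; for a Hoelder \<open>F\<close> this fails when \<open>r\<^sub>k\<close> is small.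
  The decay of the step sizes is chosen so that Young's inequality restores it up to a
  harmonic term: \<open>E\<^sub>k \<le> d\<^sup>2 r\<^sub>k\<^sup>2 + C / (k+1)\<close>, where \<open>C\<close> is a multiple of
  \<open>\<Sum> (1 - \<alpha>\<^sub>i) / \<alpha>\<^sub>i\<close> (lemma \<open>holder_sum_error\<close>).

  Telescoping bounds \<open>\<Sum> r\<^sub>k\<^sup>2\<close>, and hence \<open>\<Sum> s\<^bsub>k+1\<^esub>\<^sup>2 \<parallel>u\<^sub>k\<parallel>\<^sup>2\<close>, by a constant plus a multiple of
  \<open>C\<close> times a harmonic number. The weights \<open>s\<^bsub>k+1\<^esub>\<^sup>2\<close> add up to at least a multiple of
  \<open>(K+1)\<^sup>\<alpha>\<close>, so the smallest \<open>\<parallel>u\<^sub>k\<parallel>\<^sup>2\<close> obeys the stated bound (lemma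
  \<open>min_residual_weighted_bound\<close>). The logarithm enters only multiplied by \<open>C\<close>, which is why the
  estimate is \<open>O(1/K)\<close> if every \<open>\<alpha>\<^sub>i\<close> is \<open>1\<close>.\<close>

section \<open>The error from Hoelder continuity\<close>

text \<open>Weighted arithmetic-geometric mean: \<open>t\<close> absorbs the homogeneity that \<open>r\<^bsup>2a\<^esup>\<close> lacks
  compared with \<open>r\<^sup>2\<close>.\<close>

lemma holder_power_young:
  fixes r t a :: real
  assumes "0 \<le> r" "0 < t" "0 < a" "a \<le> 1"
  shows "(r powr a)\<^sup>2 * t powr (1 - a) \<le> a * r\<^sup>2 + (1 - a) * t"
proof (cases "r = 0")
  case True
  then show ?thesis using assms by simp
next
  case False
  then have "r > 0" using assms by simp
  then have "(r powr a)\<^sup>2 = (r\<^sup>2) powr a"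
    by (simp add: power2_eq_square powr_mult)
  moreover have "(r\<^sup>2) powr a * t powr (1 - a) \<le> a * r\<^sup>2 + (1 - a) * t"
    using assms \<open>r > 0\<close> by (intro Youngs_inequality_0) auto
  ultimately show ?thesis by simp
qed

text \<open>The step size enters squared as \<open>t\<^bsup>1-\<alpha>\<^esup> \<le> t\<^bsup>1-a i\<^esup>\<close>, which is the factor that Young's
  inequality needs for the exponent \<open>a i\<close>. The bound on \<open>s\<close> limits the coefficient of
  \<open>r\<^sup>2 = \<parallel>u - v\<parallel>\<^sup>2\<close> to \<open>d\<^sup>2 / N\<close> for each summand.\<close>

lemma holder_sum_error:
  fixes Fi :: "nat \<Rightarrow> 'a::real_normed_vector \<Rightarrow> 'a" and L a :: "nat \<Rightarrow> real"
  assumes N: "N \<ge> 1"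
    and a: "\<And>i. i \<in> {1..N} \<Longrightarrow> 0 < a i \<and> a i \<le> 1"
    and L: "\<And>i. i \<in> {1..N} \<Longrightarrow> L i > 0"
    and H: "\<And>i u v. i \<in> {1..N} \<Longrightarrow> norm (Fi i u - Fi i v) \<le> L i * norm (u - v) powr a i"
    and al: "\<And>i. i \<in> {1..N} \<Longrightarrow> \<alpha> \<le> a i"
    and s: "0 < s" "\<And>i. i \<in> {1..N} \<Longrightarrow> s \<le> 1 / (real N * L i * sqrt (a i))"
    and t: "0 < t" "t \<le> 1"
  shows "(d * s * t powr ((1 - \<alpha>) / 2) * norm ((\<Sum>i=1..N. Fi i u) - (\<Sum>i=1..N. Fi i v)))\<^sup>2
    \<le> d\<^sup>2 * (norm (u - v))\<^sup>2 + (\<Sum>i=1..N. (1 - a i) * d\<^sup>2 / (real N * a i)) * t"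
proof -
  define r where "r = norm (u - v)"
  define \<sigma> where "\<sigma> = d * s * t powr ((1 - \<alpha>) / 2)"
  have r0: "r \<ge> 0" by (simp add: r_def)
  have N0: "real N > 0" using N by simp
  have \<sigma>2: "\<sigma>\<^sup>2 = d\<^sup>2 * (s\<^sup>2 * t powr (1 - \<alpha>))"
    using t by (simp add: \<sigma>_def power_mult_distrib power2_eq_square mult_ac flip: powr_add)
  have summand: "\<sigma>\<^sup>2 * (real N * (L i * r powr a i)\<^sup>2)
      \<le> d\<^sup>2 * r\<^sup>2 / real N + (1 - a i) * d\<^sup>2 / (real N * a i) * t" if i: "i \<in> {1..N}" for i
  proof -
    have ai: "0 < a i" "a i \<le> 1" and Li: "L i > 0" using a L i by auto
    have "s * (real N * L i * sqrt (a i)) \<le> 1"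
      using s(2)[OF i] ai Li N0 by (simp add: field_simps)
    moreover have "0 \<le> s * (real N * L i * sqrt (a i))"
      using s(1) ai Li N0 by simp
    ultimately have "(s * (real N * L i * sqrt (a i)))\<^sup>2 \<le> 1"
      by (simp add: power_le_one)
    then have "s\<^sup>2 * (real N)\<^sup>2 * (L i)\<^sup>2 * a i \<le> 1"
      using ai by (simp add: power_mult_distrib mult.assoc)
    then have sL: "s\<^sup>2 * (real N * (L i)\<^sup>2) \<le> 1 / (real N * a i)"
      using ai N0 by (simp add: field_simps power2_eq_square)
    have "t powr (1 - \<alpha>) \<le> t powr (1 - a i)"
      using t al[OF i] by (intro powr_mono') auto
    then have "(r powr a i)\<^sup>2 * t powr (1 - \<alpha>) \<le> (r powr a i)\<^sup>2 * t powr (1 - a i)"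
      by (intro mult_left_mono) auto
    also have "\<dots> \<le> a i * r\<^sup>2 + (1 - a i) * t"
      using holder_power_young[OF r0 t(1) ai] .
    finally have y: "(r powr a i)\<^sup>2 * t powr (1 - \<alpha>) \<le> a i * r\<^sup>2 + (1 - a i) * t" .
    have "\<sigma>\<^sup>2 * (real N * (L i * r powr a i)\<^sup>2)
        = d\<^sup>2 * ((s\<^sup>2 * (real N * (L i)\<^sup>2)) * ((r powr a i)\<^sup>2 * t powr (1 - \<alpha>)))"
      by (simp add: \<sigma>2 power_mult_distrib mult_ac)
    also have "\<dots> \<le> d\<^sup>2 * (1 / (real N * a i) * (a i * r\<^sup>2 + (1 - a i) * t))"
      using sL y ai N0 by (intro mult_left_mono mult_mono) auto
    also have "\<dots> = d\<^sup>2 * r\<^sup>2 / real N + (1 - a i) * d\<^sup>2 / (real N * a i) * t"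
      using ai N0 by (simp add: field_simps)
    finally show ?thesis .
  qed
  have "norm ((\<Sum>i=1..N. Fi i u) - (\<Sum>i=1..N. Fi i v)) \<le> (\<Sum>i=1..N. L i * r powr a i)"
    unfolding r_def sum_subtractf[symmetric] by (intro sum_norm_le H)
  then have "(norm ((\<Sum>i=1..N. Fi i u) - (\<Sum>i=1..N. Fi i v)))\<^sup>2 \<le> (\<Sum>i=1..N. L i * r powr a i)\<^sup>2"
    by (intro power_mono) auto
  also have "\<dots> \<le> (\<Sum>i=1..N. real N * (L i * r powr a i)\<^sup>2)"
    using sum_squared_le_sum_of_squares[of "\<lambda>i. L i * r powr a i" "{1..N}"]
    by (simp add: sum_distrib_left mult.commute)
  finally have "(\<sigma> * norm ((\<Sum>i=1..N. Fi i u) - (\<Sum>i=1..N. Fi i v)))\<^sup>2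
      \<le> \<sigma>\<^sup>2 * (\<Sum>i=1..N. real N * (L i * r powr a i)\<^sup>2)"
    unfolding power_mult_distrib by (intro mult_left_mono) auto
  also have "\<dots> = (\<Sum>i=1..N. \<sigma>\<^sup>2 * (real N * (L i * r powr a i)\<^sup>2))"
    by (rule sum_distrib_left)
  also have "\<dots> \<le> (\<Sum>i=1..N. d\<^sup>2 * r\<^sup>2 / real N + (1 - a i) * d\<^sup>2 / (real N * a i) * t)"
    by (intro sum_mono summand)
  also have "\<dots> = d\<^sup>2 * r\<^sup>2 + (\<Sum>i=1..N. (1 - a i) * d\<^sup>2 / (real N * a i)) * t"
    using N0 by (simp add: sum.distrib sum_distrib_right)
  finally show ?thesis by (simp add: \<sigma>_def r_def)
qed

section \<open>One step of Tseng's method\<close>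

text \<open>Tseng's correction of the forward-backward point is exactly what turns the iteration into
  \<open>x' = x - \<sigma> u\<close> with \<open>u \<in> T y\<close>. Monotonicity compares \<open>u\<close> with the solution at \<open>y\<close> rather than
  at \<open>x\<close>, and the mismatch \<open>x - y - \<sigma> u = \<sigma> (F x - F y)\<close> is what remains as an error.\<close>

lemma tseng_step:
  fixes G :: "'a::real_inner \<Rightarrow> 'a set" and F :: "'a \<Rightarrow> 'a"
  assumes mono: "monotone_operator (op_plus F G)" and sol: "0 \<in> op_plus F G p"
    and \<sigma>: "\<sigma> > 0"
    and y: "y \<in> resolvent \<sigma> G (x - \<sigma> *\<^sub>R F x)"
    and x': "x' = y - \<sigma> *\<^sub>R (F y - F x)"
  obtains u where "u \<in> op_plus F G y"
    and "(norm (x' - p))\<^sup>2 \<le> (norm (x - p))\<^sup>2 - (norm (x - y))\<^sup>2 + (\<sigma> * norm (F y - F x))\<^sup>2"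
    and "\<sigma>\<^sup>2 * (norm u)\<^sup>2 \<le> 2 * (norm (x - y))\<^sup>2 + 2 * (\<sigma> * norm (F y - F x))\<^sup>2"
proof -
  obtain g where g: "g \<in> G y" "x - \<sigma> *\<^sub>R F x = y + \<sigma> *\<^sub>R g"
    using y by (auto simp: resolvent_def op_inverse_def op_plus_def op_scale_def)
  define u where "u = F y + g"
  define w where "w = \<sigma> *\<^sub>R u"
  define e where "e = \<sigma> *\<^sub>R (F y - F x)"
  have u: "u \<in> op_plus F G y"
    using g by (auto simp: op_plus_def u_def)
  have w: "w = (x - y) + e"
    using g(2) by (simp add: w_def u_def e_def algebra_simps)
  have x'w: "x' = x - w" by (simp add: w x' e_def)
  have ne: "(norm e)\<^sup>2 = (\<sigma> * norm (F y - F x))\<^sup>2"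
    using \<sigma> by (simp add: e_def)
  have "(u - 0) \<bullet> (y - p) \<ge> 0"
    using mono u sol unfolding monotone_operator_def by blast
  then have "w \<bullet> (y - p) \<ge> 0" using \<sigma> by (simp add: w_def)
  moreover have "(norm (x' - p))\<^sup>2
      = (norm (x - p))\<^sup>2 - (norm (x - y))\<^sup>2 + (norm e)\<^sup>2 - 2 * (w \<bullet> (y - p))"
    unfolding power2_norm_eq_inner x'w w
    by (simp add: inner_simps inner_commute algebra_simps)
  ultimately have "(norm (x' - p))\<^sup>2
      \<le> (norm (x - p))\<^sup>2 - (norm (x - y))\<^sup>2 + (\<sigma> * norm (F y - F x))\<^sup>2"
    using ne by simp
  moreover have "(norm w)\<^sup>2 + (norm ((x - y) - e))\<^sup>2 = 2 * (norm (x - y))\<^sup>2 + 2 * (norm e)\<^sup>2"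
    unfolding power2_norm_eq_inner w by (simp add: inner_simps inner_commute algebra_simps)
  then have "(norm w)\<^sup>2 \<le> 2 * (norm (x - y))\<^sup>2 + 2 * (norm e)\<^sup>2"
    using zero_le_power2[of "norm ((x - y) - e)"] by linarith
  then have "\<sigma>\<^sup>2 * (norm u)\<^sup>2 \<le> 2 * (norm (x - y))\<^sup>2 + 2 * (\<sigma> * norm (F y - F x))\<^sup>2"
    using ne by (simp add: w_def power_mult_distrib)
  ultimately show thesis using that u by blast
qed

section \<open>Summation and the convergence rate\<close>

text \<open>The minimum is at most the average weighted by \<open>w\<^sub>k = c (k+1)\<^bsup>\<alpha>-1\<^esup>\<close>. Each weight with
  \<open>k \<le> K\<close> is at least \<open>c (K+1)\<^bsup>\<alpha>-1\<^esup>\<close>, so the total weight is at least \<open>c (K+1)\<^sup>\<alpha>\<close>.\<close>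

lemma min_residual_weighted_bound:
  fixes e r m :: "nat \<Rightarrow> real"
  assumes e: "\<And>k. 0 \<le> e k" and m: "\<And>k. 0 \<le> m k"
    and q: "0 \<le> q" "q < 1" and \<alpha>: "\<alpha> \<le> 1" and c: "0 \<le> c"
    and descent: "\<And>k. e (Suc k) \<le> e k - (1 - q) * r k + C / real (k + 1)"
    and resid: "\<And>k. c * real (k + 1) powr (\<alpha> - 1) * m k \<le> 2 * (1 + q) * r k + 2 * C / real (k + 1)"
  shows "(MIN k\<in>{0..K}. m k) * (c * real (K + 1) powr \<alpha>)
    \<le> (2 * (1 + q) * e 0 + 4 * C * harm (K + 1)) / (1 - q)"
proof -
  define \<mu> where "\<mu> = (MIN k\<in>{0..K}. m k)"
  have \<mu>le: "\<mu> \<le> m k" if "k \<le> K" for k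
    unfolding \<mu>_def using that by (intro Min_le) auto
  have \<mu>0: "0 \<le> \<mu>"
    unfolding \<mu>_def using m by (subst Min_ge_iff) auto
  have tele: "(1 - q) * (\<Sum>k<n. r k) \<le> e 0 - e n + C * harm n" for n
  proof (induction n)
    case 0
    show ?case by (simp add: harm_def)
  next
    case (Suc n)
    then show ?case using descent[of n] by (simp add: harm_Suc algebra_simps divide_inverse)
  qed
  have r_sum: "(\<Sum>k<Suc K. r k) \<le> (e 0 + C * harm (Suc K)) / (1 - q)"
    using tele[of "Suc K"] e[of "Suc K"] q by (simp add: field_simps)
  have "\<mu> * (c * real (K + 1) powr \<alpha>) = (\<Sum>k<Suc K. \<mu> * (c * real (K + 1) powr (\<alpha> - 1)))"
    by (simp add: powr_diff)
  also have "\<dots> \<le> (\<Sum>k<Suc K. c * real (k + 1) powr (\<alpha> - 1) * m k)"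
  proof (intro sum_mono)
    fix k assume "k \<in> {..<Suc K}"
    then have k: "k \<le> K" by simp
    have "real (K + 1) powr (\<alpha> - 1) \<le> real (k + 1) powr (\<alpha> - 1)"
      using k \<alpha> by (intro powr_mono2') auto
    then have "\<mu> * (c * real (K + 1) powr (\<alpha> - 1)) \<le> m k * (c * real (k + 1) powr (\<alpha> - 1))"
      using \<mu>0 c \<mu>le[OF k] m[of k] by (intro mult_mono mult_left_mono) auto
    then show "\<mu> * (c * real (K + 1) powr (\<alpha> - 1)) \<le> c * real (k + 1) powr (\<alpha> - 1) * m k"
      by (simp add: mult_ac)
  qed
  also have "\<dots> \<le> (\<Sum>k<Suc K. 2 * (1 + q) * r k + 2 * C / real (k + 1))"
    by (intro sum_mono resid)
  also have "\<dots> = 2 * (1 + q) * (\<Sum>k<Suc K. r k) + 2 * C * harm (Suc K)"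
    by (simp only: harm_altdef sum.distrib sum_distrib_left divide_inverse Suc_eq_plus1)
  also have "\<dots> \<le> 2 * (1 + q) * ((e 0 + C * harm (Suc K)) / (1 - q)) + 2 * C * harm (Suc K)"
    using q by (intro add_right_mono mult_left_mono r_sum) auto
  also have "\<dots> = (2 * (1 + q) * e 0 + 4 * C * harm (K + 1)) / (1 - q)"
    using q by (simp add: field_simps)
  finally show ?thesis by (simp add: \<mu>_def)
qed

lemma harm_Suc_le_ln:
  assumes "K \<ge> 1"
  shows "harm (K + 1) \<le> 2 + ln (real K)"
proof -
  have "harm (K + 1) \<le> 1 + ln (real (K + 1))"
    using euler_mascheroni_sequence_decreasing[of 1 "K + 1"] by (simp add: harm_def)
  also have "ln (real (K + 1)) \<le> ln (2 * real K)"
    using assms by simp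
  also have "\<dots> = ln 2 + ln (real K)"
    using assms by (simp add: ln_mult)
  finally show ?thesis using ln_2_less_1 by simp
qed

theorem theorem1:
  fixes N :: nat
    and Fi :: "nat \<Rightarrow> 'a::{real_inner, complete_space} \<Rightarrow> 'a"
    and F :: "'a \<Rightarrow> 'a"
    and G T :: "'a \<Rightarrow> 'a set"
    and L \<alpha>i :: "nat \<Rightarrow> real"
    and \<alpha> d s :: real
    and step :: "nat \<Rightarrow> real"
    and x y :: "nat \<Rightarrow> 'a"
  assumes "N \<ge> 1"
    and "\<And>i. i \<in> {1..N} \<Longrightarrow> 0 < \<alpha>i i \<and> \<alpha>i i \<le> 1"
    and "\<And>i. i \<in> {1..N} \<Longrightarrow> L i > 0"
    and "\<And>i u v. i \<in> {1..N} \<Longrightarrow> norm (Fi i u - Fi i v) \<le> L i * norm (u - v) powr \<alpha>i i"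
    and "F = (\<lambda>u. \<Sum>i=1..N. Fi i u)"
    and "maximally_monotone G"
    and "T = op_plus F G"
    and "monotone_operator T"
    and "{u. 0 \<in> T u} \<noteq> {}"
    and "\<alpha> = (MIN i\<in>{1..N}. \<alpha>i i)"
    and "0 < d" and "d < 1"
    and "0 < s" and "s \<le> (MIN i\<in>{1..N}. 1 / (real N * L i * sqrt (\<alpha>i i)))"
    and "\<And>k. step (Suc k) = d * s / real (k + 1) powr ((1 - \<alpha>) / 2)"
    and "\<And>k. y (Suc k) \<in> resolvent (step (Suc k)) G (x k - step (Suc k) *\<^sub>R F (x k))"
    and "\<And>k. x (Suc k) = y (Suc k) - step (Suc k) *\<^sub>R (F (y (Suc k)) - F (x k))"
  shows "(\<lambda>K. MIN k\<in>{0..K}. (infdist 0 (T (y (Suc k))))\<^sup>2)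
    \<in> O(\<lambda>K. ((2 + 2 * d\<^sup>2) * \<alpha> / (1 - d\<^sup>2)
              + (\<Sum>i=1..N. (1 - \<alpha>i i) * \<alpha> * d\<^sup>2 * ln (real K) / (real N * (1 - d\<^sup>2) * \<alpha>i i)))
            * real K powr (- \<alpha>))"
proof -
  note N = assms(1) and ai = assms(2) and Lpos = assms(3) and hol = assms(4) and F = assms(5)
    and T = assms(7) and monoT = assms(8) and \<alpha>_Min = assms(10)
    and d = assms(11,12) and s0 = assms(13) and s_le = assms(14) and step = assms(15)
    and y_res = assms(16) and x_Suc = assms(17)
  obtain p where p: "0 \<in> op_plus F G p" using assms(9) T by auto
  have \<alpha>_le: "\<alpha> \<le> \<alpha>i i" if "i \<in> {1..N}" for i
    unfolding \<alpha>_Min using that by (intro Min_le) auto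
  have s_le': "s \<le> 1 / (real N * L i * sqrt (\<alpha>i i))" if "i \<in> {1..N}" for i
    using s_le that by (subst (asm) Min_ge_iff) auto
  have "\<alpha> \<in> \<alpha>i ` {1..N}" unfolding \<alpha>_Min using N by (intro Min_in) auto
  then have \<alpha>: "0 < \<alpha>" "\<alpha> \<le> 1" using ai by auto
  have d2: "0 < d\<^sup>2" "d\<^sup>2 < 1" using d by (auto simp: power_less_one_iff)
  define C where "C = (\<Sum>i=1..N. (1 - \<alpha>i i) * d\<^sup>2 / (real N * \<alpha>i i))"
  define c where "c = d\<^sup>2 * s\<^sup>2"
  define r where "r k = (norm (x k - y (Suc k)))\<^sup>2" for k
  define m where "m k = (infdist 0 (T (y (Suc k))))\<^sup>2" for k
  define e where "e k = (norm (x k - p))\<^sup>2" for k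
  have C0: "0 \<le> C" unfolding C_def using ai by (intro sum_nonneg) (simp add: less_imp_le)
  have c0: "0 < c" using d2 s0 by (simp add: c_def)
  have step_t: "step (Suc k) = d * s * (1 / real (k + 1)) powr ((1 - \<alpha>) / 2)" for k
    by (simp add: step powr_divide)
  have step_pos: "step (Suc k) > 0" for k
    using d s0 by (simp add: step)
  have step_sq: "(step (Suc k))\<^sup>2 = c * real (k + 1) powr (\<alpha> - 1)" for k
  proof -
    have "((real (k + 1)) powr ((1 - \<alpha>) / 2))\<^sup>2 = real (k + 1) powr (1 - \<alpha>)"
      by (simp add: power2_eq_square flip: powr_add)
    moreover have "real (k + 1) powr (\<alpha> - 1) = 1 / real (k + 1) powr (1 - \<alpha>)"
      using powr_minus_divide[of "real (k + 1)" "1 - \<alpha>"] by simp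
    ultimately show ?thesis
      unfolding step c_def by (simp add: power_divide power_mult_distrib)
  qed
  have error: "(step (Suc k) * norm (F (y (Suc k)) - F (x k)))\<^sup>2 \<le> d\<^sup>2 * r k + C / real (k + 1)" for k
    using holder_sum_error[OF N ai Lpos hol \<alpha>_le s0 s_le', where t = "1 / real (k + 1)" and d = d
        and u = "y (Suc k)" and v = "x k"]
    unfolding step_t F C_def r_def by (simp add: norm_minus_commute)
  have descent: "e (Suc k) \<le> e k - (1 - d\<^sup>2) * r k + C / real (k + 1)"
    and resid: "c * real (k + 1) powr (\<alpha> - 1) * m k \<le> 2 * (1 + d\<^sup>2) * r k + 2 * C / real (k + 1)"
    for k
  proof -
    obtain u where u: "u \<in> op_plus F G (y (Suc k))"
      and u1: "e (Suc k) \<le> e k - r k + (step (Suc k) * norm (F (y (Suc k)) - F (x k)))\<^sup>2"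
      and u2: "(step (Suc k))\<^sup>2 * (norm u)\<^sup>2
        \<le> 2 * r k + 2 * (step (Suc k) * norm (F (y (Suc k)) - F (x k)))\<^sup>2"
      using tseng_step[OF monoT[unfolded T] p step_pos y_res x_Suc] unfolding e_def r_def by blast
    show "e (Suc k) \<le> e k - (1 - d\<^sup>2) * r k + C / real (k + 1)"
      using u1 error[of k] by (simp add: algebra_simps)
    have "infdist 0 (T (y (Suc k))) \<le> norm u"
      using infdist_le[of u "T (y (Suc k))" 0] u by (simp add: T)
    then have "m k \<le> (norm u)\<^sup>2"
      unfolding m_def by (intro power_mono infdist_nonneg)
    then have "(step (Suc k))\<^sup>2 * m k \<le> (step (Suc k))\<^sup>2 * (norm u)\<^sup>2"
      by (intro mult_left_mono) auto
    also note u2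
    also have "2 * r k + 2 * (step (Suc k) * norm (F (y (Suc k)) - F (x k)))\<^sup>2
        \<le> 2 * r k + 2 * (d\<^sup>2 * r k + C / real (k + 1))"
      by (intro add_left_mono mult_left_mono error) simp
    finally show "c * real (k + 1) powr (\<alpha> - 1) * m k \<le> 2 * (1 + d\<^sup>2) * r k + 2 * C / real (k + 1)"
      by (simp add: step_sq algebra_simps)
  qed
  have m0: "0 \<le> m k" for k by (simp add: m_def)
  define P where "P = (2 + 2 * d\<^sup>2) * \<alpha> / (1 - d\<^sup>2)"
  define A where "A = (2 * (1 + d\<^sup>2) * e 0 + 8 * C) / (1 - d\<^sup>2)"
  have P0: "P > 0" unfolding P_def using \<alpha> d2 by (intro divide_pos_pos mult_pos_pos add_pos_pos) auto
  have A0: "A \<ge> 0" unfolding A_def e_def using C0 d2 by (intro divide_nonneg_pos add_nonneg_nonneg) auto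
  have log_coeff: "(\<Sum>i=1..N. (1 - \<alpha>i i) * \<alpha> * d\<^sup>2 * ln (real K) / (real N * (1 - d\<^sup>2) * \<alpha>i i))
      = \<alpha> * C / (1 - d\<^sup>2) * ln (real K)" for K
    unfolding C_def sum_distrib_left sum_distrib_right sum_divide_distrib
    by (intro sum.cong) (auto simp: mult_ac)
  \<comment> \<open>\<open>A / P\<close> matches the constant part and \<open>4 / \<alpha>\<close> the logarithmic part, so the
    comparison also covers \<open>C = 0\<close>, where the logarithm disappears.\<close>
  define M where "M = (A / P + 4 / \<alpha>) / c"
  have bound: "(MIN k\<in>{0..K}. m k) \<le> M * ((P + \<alpha> * C / (1 - d\<^sup>2) * ln (real K)) * real K powr (- \<alpha>))"
    if K: "K \<ge> 1" for K
  proof -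
    define Q where "Q = \<alpha> * C / (1 - d\<^sup>2) * ln (real K)"
    have Q0: "Q \<ge> 0" unfolding Q_def using \<alpha> C0 d2 K by simp
    have \<mu>0: "0 \<le> (MIN k\<in>{0..K}. m k)" using m0 by (subst Min_ge_iff) auto
    have "(MIN k\<in>{0..K}. m k) * (c * real K powr \<alpha>) \<le> (MIN k\<in>{0..K}. m k) * (c * real (K + 1) powr \<alpha>)"
      using c0 \<alpha> \<mu>0 by (intro mult_left_mono powr_mono2) auto
    also have "\<dots> \<le> (2 * (1 + d\<^sup>2) * e 0 + 4 * C * harm (K + 1)) / (1 - d\<^sup>2)"
      using min_residual_weighted_bound[OF _ m0 _ d2(2) \<alpha>(2) _ descent resid, where K = K] c0
      by (simp add: e_def)
    also have "\<dots> \<le> (2 * (1 + d\<^sup>2) * e 0 + 4 * C * (2 + ln (real K))) / (1 - d\<^sup>2)"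
      using harm_Suc_le_ln[OF K] C0 d2 by (intro divide_right_mono add_left_mono mult_left_mono) auto
    also have "\<dots> = A + 4 / \<alpha> * Q"
    proof -
      have "4 / \<alpha> * Q = 4 * C * ln (real K) / (1 - d\<^sup>2)"
        using \<alpha> by (simp add: Q_def)
      then show ?thesis
        by (simp add: A_def algebra_simps flip: add_divide_distrib)
    qed
    also have "\<dots> \<le> (A / P + 4 / \<alpha>) * (P + Q)"
    proof -
      have "0 \<le> A / P * Q" "0 \<le> 4 / \<alpha> * P" using A0 P0 Q0 \<alpha> by auto
      moreover have "(A / P + 4 / \<alpha>) * (P + Q) = A + A / P * Q + 4 / \<alpha> * P + 4 / \<alpha> * Q"
        using P0 by (simp add: distrib_left distrib_right add_divide_distrib)
      ultimately show ?thesis by linarith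
    qed
    finally have "(MIN k\<in>{0..K}. m k) \<le> (A / P + 4 / \<alpha>) * (P + Q) / (c * real K powr \<alpha>)"
      using c0 K by (simp add: pos_le_divide_eq)
    also have "\<dots> = M * ((P + Q) * real K powr (- \<alpha>))"
      by (simp add: M_def powr_minus divide_inverse mult_ac)
    finally show ?thesis by (simp add: Q_def)
  qed
  show ?thesis
    unfolding log_coeff P_def[symmetric] m_def[symmetric]
  proof (rule bigoI[where c = M], rule eventually_sequentiallyI[of 1])
    fix K :: nat assume K: "1 \<le> K"
    have "0 \<le> (MIN k\<in>{0..K}. m k)" using m0 by (subst Min_ge_iff) auto
    moreover have "0 \<le> (P + \<alpha> * C / (1 - d\<^sup>2) * ln (real K)) * real K powr (- \<alpha>)"
      using P0 \<alpha> C0 d2 K by (intro mult_nonneg_nonneg add_nonneg_nonneg) auto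
    ultimately show "norm (MIN k\<in>{0..K}. m k)
        \<le> M * norm ((P + \<alpha> * C / (1 - d\<^sup>2) * ln (real K)) * real K powr (- \<alpha>))"
      using bound[OF K] by simp
  qed
qed

end
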